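(* Let $G=(V,E)$ be a finite graph with $n=|V|$ and $\mathrm{Ric}(G)\ge K$ for some $K\in\mathbb R$, and let $\rho$ be its log-Sobolev (hypercontractivity) constant. Then for every nonempty subset $A\subset V$ with $|A|\le n/2$, $$|\partial A|\ge\frac1{16}\min\Big(\sqrt\rho,\frac{\rho}{\sqrt{2|K|}}\Big)\,|A|\Big(\log\frac{n}{|A|}\Big)^{1/2},$$ where $\partial A$ is the set of edges between $A$ and $V\setminus A$ (and $\rho/\sqrt{2|K|}$ is interpreted as $+\infty$ when $K=0$).
   Context: Let $G=(V,E)$ be an undirected simple graph with no isolated vertices; $y\sim x$ means adjacency. For $f,g:V\to\mathbb R$ define $\Delta f(x)=\sum_{y\sim x}(f(y)-f(x))$, $\Gamma(f,g)(x)=\frac12\sum_{y\sim x}(f(x)-f(y))(g(x)-g(y))$, $\Gamma(f)=\Gamma(f,f)$, $\Gamma_2(f)=\frac12\Delta\Gamma(f)-\Gamma(f,\Delta f)$. "$\mathrm{Ric}(G)\ge K$" means $\Gamma_2(f)(x)\ge K\,\Gamma(f)(x)$ for all $f:V\to\mathbb R$ and $x\in V$. The heat kernel is $P_t=\exp(t\Delta)$ and $\|f\|_p=(\sum_{v}|f(v)|^p)^{1/p}$. The constant $\rho$ is the greatest value such that whenever $1<r<q<\infty$, $t\ge0$ and $\sqrt{(q-1)/(r-1)}\le e^{\rho t}$, one has $n^{-1/q}\|P_tf\|_q\le n^{-1/r}\|f\|_r$ for all $f:V\to\mathbb R$. *)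

theory Defs
  imports Complex_Main
begin

text \<open>Edges are two-element subsets of the vertex set, so \<open>x \<sim> y\<close> reads \<open>{x, y} \<in> E\<close>.
  A function \<open>V \<rightarrow> \<real>\<close> is a total function whose values off \<open>V\<close> are never inspected at
  vertices of \<open>V\<close>.\<close>

locale simple_graph =
  fixes V :: "'a set" and E :: "'a set set"
  assumes edges: "e \<in> E \<Longrightarrow> e \<subseteq> V \<and> card e = 2"
    and no_isolated: "x \<in> V \<Longrightarrow> \<exists>y. {x, y} \<in> E"

definition laplacian :: "'a set set \<Rightarrow> ('a \<Rightarrow> real) \<Rightarrow> 'a \<Rightarrow> real" where
  "laplacian E f x = (\<Sum>y | {x, y} \<in> E. f y - f x)"

definition Gam :: "'a set set \<Rightarrow> ('a \<Rightarrow> real) \<Rightarrow> ('a \<Rightarrow> real) \<Rightarrow> 'a \<Rightarrow> real" where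
  "Gam E f g x = 1/2 * (\<Sum>y | {x, y} \<in> E. (f x - f y) * (g x - g y))"

definition Gam2 :: "'a set set \<Rightarrow> ('a \<Rightarrow> real) \<Rightarrow> 'a \<Rightarrow> real" where
  "Gam2 E f x = 1/2 * laplacian E (Gam E f f) x - Gam E f (laplacian E f) x"

definition Ric_ge :: "'a set \<Rightarrow> 'a set set \<Rightarrow> real \<Rightarrow> bool" where
  "Ric_ge V E K \<longleftrightarrow> (\<forall>f. \<forall>x\<in>V. Gam2 E f x \<ge> K * Gam E f f x)"

text \<open>The heat semigroup \<open>exp (t \<Delta>)\<close>, as the exponential series of the operator \<open>t \<Delta>\<close>
  (for finite \<open>V\<close> it converges absolutely at every vertex).\<close>

definition heat :: "'a set set \<Rightarrow> real \<Rightarrow> ('a \<Rightarrow> real) \<Rightarrow> 'a \<Rightarrow> real" where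
  "heat E t f x = (\<Sum>k. t ^ k / fact k * (laplacian E ^^ k) f x)"

definition lp_norm :: "'a set \<Rightarrow> real \<Rightarrow> ('a \<Rightarrow> real) \<Rightarrow> real" where
  "lp_norm V p f = (\<Sum>v\<in>V. \<bar>f v\<bar> powr p) powr (1 / p)"

definition hypercontractive :: "'a set \<Rightarrow> 'a set set \<Rightarrow> real \<Rightarrow> bool" where
  "hypercontractive V E \<rho> \<longleftrightarrow>
    (\<forall>r q t. 1 < r \<and> r < q \<and> 0 \<le> t \<and> sqrt ((q - 1) / (r - 1)) \<le> exp (\<rho> * t) \<longrightarrow>
      (\<forall>f. real (card V) powr (- 1 / q) * lp_norm V q (heat E t f)
         \<le> real (card V) powr (- 1 / r) * lp_norm V r f))"

definition log_sobolev_const :: "'a set \<Rightarrow> 'a set set \<Rightarrow> real" where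
  "log_sobolev_const V E = (GREATEST \<rho>. hypercontractive V E \<rho>)"

definition edge_boundary :: "'a set \<Rightarrow> 'a set set \<Rightarrow> 'a set \<Rightarrow> 'a set set" where
  "edge_boundary V E A = {e \<in> E. \<exists>x\<in>A. \<exists>y\<in>V - A. e = {x, y}}"

end

theory Submission imports Defs "HOL-Library.Indicator_Function" begin

text \<open>Write \<open>P\<^sub>t\<close> for the heat semigroup and \<open>f\<close> for the indicator of \<open>A\<close>. Interpolating
  \<open>P\<^bsub>t-s\<^esub> ((P\<^sub>s f)\<^sup>2 + s \<Gamma>(P\<^sub>s f))\<close> over \<open>0 \<le> s \<le> t\<close>, the curvature bound makes this expression
  nonincreasing in \<open>s\<close> as long as \<open>2 K t \<ge> -1\<close>, so \<open>t \<Gamma>(P\<^sub>t f) \<le> P\<^sub>t f - (P\<^sub>t f)\<^sup>2 \<le> 1/4\<close>. Hence the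
  heat flowing out of \<open>A\<close> up to time \<open>t\<close> is at most \<open>sqrt (2 t)\<close> times the size of the edge boundary.
  On the other hand the heat remaining in \<open>A\<close> at time \<open>t\<close> is the squared 2-norm of \<open>P\<^bsub>t/2\<^esub> f\<close>, which
  hypercontractivity bounds by \<open>|A|\<close> times \<open>|A|/n\<close> to the power \<open>tanh (\<rho> t / 2)\<close>. The theorem follows
  with \<open>t\<close> the smaller of \<open>1 / (\<rho> log (n/|A|))\<close> and \<open>1 / (2 |K|)\<close>.\<close>

locale finite_graph = simple_graph V E for V :: "'a set" and E :: "'a set set" +
  assumes finite_V: "finite V"
begin

section \<open>Laplacian and carre du champ as weighted sums over \<open>V\<close>\<close>

definition adj :: "'a \<Rightarrow> 'a \<Rightarrow> real" where
  "adj x y = of_bool ({x, y} \<in> E)"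

lemma adj_sym: "adj x y = adj y x"
  by (simp add: adj_def insert_commute)

lemma adj_nonneg [simp]: "0 \<le> adj x y"
  by (simp add: adj_def)

text \<open>Trades a range depending on \<open>x\<close> for the fixed range \<open>V\<close> with
  0/1 weights, so that double sums can be swapped.\<close>

lemma neighbour_sum: "(\<Sum>y | {x, y} \<in> E. g y) = (\<Sum>y\<in>V. adj x y * g y)"
proof -
  have "{y. {x, y} \<in> E} = {y \<in> V. {x, y} \<in> E}"
    using edges by auto
  then have "(\<Sum>y | {x, y} \<in> E. g y) = (\<Sum>y\<in>V. if {x, y} \<in> E then g y else 0)"
    by (simp add: sum.inter_filter finite_V)
  also have "\<dots> = (\<Sum>y\<in>V. adj x y * g y)"
    by (intro sum.cong) (auto simp: adj_def)
  finally show ?thesis .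
qed

lemma laplacian_adj: "laplacian E f x = (\<Sum>y\<in>V. adj x y * (f y - f x))"
  by (simp add: laplacian_def neighbour_sum)

lemma Gam_adj: "Gam E f g x = 1/2 * (\<Sum>y\<in>V. adj x y * ((f x - f y) * (g x - g y)))"
  by (simp add: Gam_def neighbour_sum)

lemma Gam_nonneg: "0 \<le> Gam E f f x"
  by (auto simp: Gam_adj intro!: sum_nonneg mult_nonneg_nonneg[OF adj_nonneg])

lemma sq_diff_le_Gam:
  assumes "y \<in> V" "{x, y} \<in> E"
  shows "(f x - f y)\<^sup>2 \<le> 2 * Gam E f f x"
proof -
  have "adj x y * ((f x - f y) * (f x - f y)) \<le> (\<Sum>y\<in>V. adj x y * ((f x - f y) * (f x - f y)))"
    using assms finite_V by (intro member_le_sum) auto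
  then show ?thesis
    using assms by (simp add: Gam_adj adj_def power2_eq_square)
qed

text \<open>\<open>Gam\<close> is the defect of the Leibniz rule for the Laplacian; this drives the
  cancellation in \<open>heat_gradient_bound\<close>.\<close>

lemma laplacian_square: "laplacian E (\<lambda>y. (f y)\<^sup>2) x = 2 * f x * laplacian E f x + 2 * Gam E f f x"
  by (simp add: laplacian_adj Gam_adj sum_distrib_left flip: sum.distrib)
    (intro sum.cong refl, simp add: power2_eq_square algebra_simps)

lemma laplacian_add_cmult:
  "laplacian E (\<lambda>y. f y + c * g y) x = laplacian E f x + c * laplacian E g x"
  by (simp add: laplacian_adj sum_distrib_left flip: sum.distrib)
    (intro sum.cong refl, simp add: algebra_simps)

text \<open>The diagonal terms \<open>f x * g x\<close> cancel, and the remaining double sum is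
  symmetric in the two vertices.\<close>

lemma laplacian_selfadjoint:
  "(\<Sum>x\<in>V. f x * laplacian E g x) = (\<Sum>x\<in>V. laplacian E f x * g x)"
proof -
  have "(\<Sum>x\<in>V. f x * laplacian E g x) - (\<Sum>x\<in>V. laplacian E f x * g x)
      = (\<Sum>x\<in>V. \<Sum>y\<in>V. adj x y * (f x * g y)) - (\<Sum>x\<in>V. \<Sum>y\<in>V. adj x y * (f y * g x))"
    by (simp add: laplacian_adj sum_distrib_left sum_distrib_right algebra_simps
        flip: sum_subtractf)
  also have "(\<Sum>x\<in>V. \<Sum>y\<in>V. adj x y * (f y * g x)) = (\<Sum>x\<in>V. \<Sum>y\<in>V. adj x y * (f x * g y))"
    by (subst sum.swap) (simp add: adj_sym)
  finally show ?thesis by simp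
qed

subsection \<open>The heat equation\<close>

text \<open>A crude operator bound in the sup norm; iterated, it dominates the heat series by an
  exponential series.\<close>

lemma laplacian_bound:
  assumes "\<And>y. y \<in> V \<Longrightarrow> \<bar>f y\<bar> \<le> M" "x \<in> V"
  shows "\<bar>laplacian E f x\<bar> \<le> 2 * real (card V) * M"
proof -
  have "\<bar>laplacian E f x\<bar> \<le> (\<Sum>y\<in>V. \<bar>adj x y * (f y - f x)\<bar>)"
    unfolding laplacian_adj by (rule sum_abs)
  also have "\<dots> \<le> (\<Sum>y\<in>V. 2 * M)"
  proof (rule sum_mono)
    fix y assume "y \<in> V"
    then show "\<bar>adj x y * (f y - f x)\<bar> \<le> 2 * M"
      using assms(1)[of y] assms(1)[OF \<open>x \<in> V\<close>] by (auto simp: adj_def)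
  qed
  finally show ?thesis by simp
qed

lemma laplacian_pow_bound:
  assumes "\<And>y. y \<in> V \<Longrightarrow> \<bar>f y\<bar> \<le> M"
  shows "x \<in> V \<Longrightarrow> \<bar>(laplacian E ^^ k) f x\<bar> \<le> (2 * real (card V)) ^ k * M"
proof (induction k arbitrary: x)
  case 0
  then show ?case using assms by simp
next
  case (Suc k)
  then show ?case
    using laplacian_bound[of "(laplacian E ^^ k) f" "(2 * real (card V)) ^ k * M" x] by simp
qed

lemma heat_summable:
  assumes "x \<in> V"
  shows "summable (\<lambda>k. t ^ k / fact k * (laplacian E ^^ k) f x)"
proof (rule summable_comparison_test')
  define M where "M = (\<Sum>y\<in>V. \<bar>f y\<bar>)"
  have M: "\<bar>f y\<bar> \<le> M" if "y \<in> V" for y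
    unfolding M_def using that finite_V by (intro member_le_sum) auto
  show "summable (\<lambda>k. M * (inverse (fact k) * (\<bar>t\<bar> * (2 * real (card V))) ^ k))"
    by (intro summable_mult summable_exp)
  fix k :: nat
  have "\<bar>t\<bar> ^ k / fact k * \<bar>(laplacian E ^^ k) f x\<bar> \<le> \<bar>t\<bar> ^ k / fact k * ((2 * real (card V)) ^ k * M)"
    by (intro mult_left_mono laplacian_pow_bound M assms) auto
  then show "norm (t ^ k / fact k * (laplacian E ^^ k) f x)
      \<le> M * (inverse (fact k) * (\<bar>t\<bar> * (2 * real (card V))) ^ k)"
    by (simp add: abs_mult power_abs divide_inverse mult_ac power_mult_distrib)
qed

lemma heat_laplacian:
  assumes "x \<in> V"
  shows "heat E t (laplacian E f) x = laplacian E (heat E t f) x"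
proof -
  have "laplacian E (heat E t f) x
      = (\<Sum>y\<in>V. \<Sum>k. adj x y * (t ^ k / fact k * (laplacian E ^^ k) f y - t ^ k / fact k * (laplacian E ^^ k) f x))"
    unfolding laplacian_adj[of "heat E t f"] heat_def using assms
    by (intro sum.cong refl)
      (simp only: suminf_diff suminf_mult heat_summable summable_diff)
  also have "\<dots> = (\<Sum>k. \<Sum>y\<in>V. adj x y * (t ^ k / fact k * (laplacian E ^^ k) f y - t ^ k / fact k * (laplacian E ^^ k) f x))"
    using assms by (intro suminf_sum[symmetric] summable_mult summable_diff heat_summable)
  also have "\<dots> = heat E t (laplacian E f) x"
    unfolding heat_def
    by (simp add: funpow_swap1[symmetric] laplacian_adj[of "(laplacian E ^^ _) f"] sum_distrib_left algebra_simps)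
  finally show ?thesis by simp
qed

lemma heat_0 [simp]: "heat E 0 f x = f x"
proof -
  have "heat E 0 f x = (\<Sum>k. ((laplacian E ^^ k) f x / fact k) * 0 ^ k)"
    unfolding heat_def by (intro suminf_cong) simp
  then show ?thesis by (simp only: powser_zero) simp
qed

lemma heat_deriv:
  assumes "x \<in> V"
  shows "((\<lambda>t. heat E t f x) has_real_derivative laplacian E (heat E t f) x) (at t)"
proof -
  let ?c = "\<lambda>k. (laplacian E ^^ k) f x / fact k"
  have "((\<lambda>t. \<Sum>k. ?c k * t ^ k) has_real_derivative (\<Sum>k. diffs ?c k * t ^ k)) (at t)"
  proof (rule termdiffs_strong_converges_everywhere)
    show "summable (\<lambda>k. ?c k * y ^ k)" for y
      using heat_summable[OF assms, of y f] by (simp add: mult.commute)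
  qed
  \<comment> \<open>Termwise differentiation shifts the index by one, which puts an extra Laplacian
    on the initial datum.\<close>
  moreover have "(\<Sum>k. diffs ?c k * t ^ k) = heat E t (laplacian E f) x"
    unfolding heat_def
    by (intro suminf_cong) (simp add: diffs_def funpow_swap1 del: of_nat_Suc)
  moreover have "(\<Sum>k. ?c k * t ^ k) = heat E t f x" for t
    unfolding heat_def by (intro suminf_cong) simp
  ultimately show ?thesis
    by (simp add: heat_laplacian assms)
qed

lemma heat_deriv_reflected:
  assumes "x \<in> V"
  shows "((\<lambda>s. heat E (t - s) f x) has_real_derivative - laplacian E (heat E (t - s) f) x) (at s)"
proof -
  have "((\<lambda>s. t - s) has_real_derivative - 1) (at s)"
    by (auto intro!: derivative_eq_intros)
  from DERIV_chain2[OF heat_deriv[OF assms] this] show ?thesis by simp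
qed

lemma heat_continuous: "x \<in> V \<Longrightarrow> continuous_on S (\<lambda>t. heat E t f x)"
  by (intro continuous_at_imp_continuous_on ballI DERIV_isCont[OF heat_deriv])

text \<open>The tool for interpolation in time: self-adjointness moves the Laplacian from the
  backward flow of \<open>g\<close> to \<open>F s\<close>, so that only the failure of
  \<open>F\<close> to solve the heat equation remains.\<close>

lemma heat_pairing_deriv:
  assumes "\<And>y. y \<in> V \<Longrightarrow> ((\<lambda>s. F s y) has_real_derivative F' y) (at s)"
  shows "((\<lambda>s. \<Sum>y\<in>V. heat E (t - s) g y * F s y) has_real_derivative
    (\<Sum>y\<in>V. heat E (t - s) g y * (F' y - laplacian E (F s) y))) (at s)"
proof -
  have "((\<lambda>s. \<Sum>y\<in>V. heat E (t - s) g y * F s y) has_real_derivative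
    (\<Sum>y\<in>V. - laplacian E (heat E (t - s) g) y * F s y + F' y * heat E (t - s) g y)) (at s)"
    by (intro DERIV_sum DERIV_mult heat_deriv_reflected assms)
  also have "(\<Sum>y\<in>V. - laplacian E (heat E (t - s) g) y * F s y + F' y * heat E (t - s) g y)
    = (\<Sum>y\<in>V. F' y * heat E (t - s) g y) - (\<Sum>y\<in>V. laplacian E (heat E (t - s) g) y * F s y)"
    by (simp add: sum_subtractf)
  also have "\<dots> = (\<Sum>y\<in>V. heat E (t - s) g y * (F' y - laplacian E (F s) y))"
    by (simp add: laplacian_selfadjoint[symmetric] right_diff_distrib sum_subtractf mult.commute)
  finally show ?thesis .
qed

text \<open>For the heat flow itself that failure is zero. Taking \<open>s = t\<close> gives
  self-adjointness of the semigroup; \<open>s = t / 2\<close> gives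
  \<open>heat_mass_eq_norm\<close>.\<close>

lemma heat_pairing_const:
  "(\<Sum>y\<in>V. heat E (t - s) g y * heat E s f y) = (\<Sum>y\<in>V. heat E t g y * f y)"
proof -
  have "((\<lambda>s. \<Sum>y\<in>V. heat E (t - s) g y * heat E s f y) has_real_derivative 0) (at s)" for s
    using heat_pairing_deriv[where F = "\<lambda>s. heat E s f", OF heat_deriv, where t = t and g = g] by simp
  then have "(\<lambda>s. \<Sum>y\<in>V. heat E (t - s) g y * heat E s f y) s
      = (\<lambda>s. \<Sum>y\<in>V. heat E (t - s) g y * heat E s f y) 0"
    by (intro DERIV_isconst_all) auto
  then show ?thesis by simp
qed

section \<open>Heat kernel and positivity\<close>

definition point :: "'a \<Rightarrow> 'a \<Rightarrow> real" where
  "point x y = of_bool (x = y)"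

lemma sum_point: "x \<in> V \<Longrightarrow> (\<Sum>y\<in>V. point x y * g y) = g x"
proof -
  assume "x \<in> V"
  have "(\<Sum>y\<in>V. point x y * g y) = (\<Sum>y\<in>V. if x = y then g y else 0)"
    by (intro sum.cong) (auto simp: point_def)
  then show ?thesis using finite_V \<open>x \<in> V\<close> by simp
qed

text \<open>\<open>heat E t (point x) y\<close> is the heat kernel; pairing with it turns pointwise
  values into the sums that \<open>heat_pairing_deriv\<close> differentiates.\<close>

lemma heat_kernel:
  assumes "x \<in> V"
  shows "heat E t f x = (\<Sum>y\<in>V. heat E t (point x) y * f y)"
  using heat_pairing_const[of t t "point x" f] sum_point[OF assms, of "heat E t f"] by simp

text \<open>Minimum principle: adding \<open>\<epsilon> (1 + s)\<close> makes the solution a strict supersolution, which cannot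
  attain a negative space-time minimum.\<close>

lemma heat_nonneg:
  assumes f: "\<And>y. y \<in> V \<Longrightarrow> 0 \<le> f y" and "0 \<le> t" "x \<in> V"
  shows "0 \<le> heat E t f x"
proof (rule ccontr)
  assume neg: "\<not> 0 \<le> heat E t f x"
  \<comment> \<open>Small enough that the added term at time \<open>t\<close> is half the depth of
    the negative value, so \<open>w t x\<close> stays negative.\<close>
  define \<epsilon> where "\<epsilon> = - heat E t f x / (2 * (1 + t))"
  define w where "w s y = heat E s f y + \<epsilon> * (1 + s)" for s y
  have "\<epsilon> > 0" unfolding \<epsilon>_def using neg \<open>0 \<le> t\<close> by (intro divide_pos_pos) auto
  have cont: "continuous_on {0..t} (\<lambda>s. w s y)" if "y \<in> V" for y
    unfolding w_def by (intro continuous_intros heat_continuous that)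
  have "\<exists>s\<in>{0..t}. \<forall>s'\<in>{0..t}. w s y \<le> w s' y" if "y \<in> V" for y
    using \<open>0 \<le> t\<close> by (intro continuous_attains_inf cont that) auto
  then obtain m where m: "\<And>y. y \<in> V \<Longrightarrow> m y \<in> {0..t}"
    "\<And>y s. y \<in> V \<Longrightarrow> s \<in> {0..t} \<Longrightarrow> w (m y) y \<le> w s y" by metis
  define z where "z = arg_min_on (\<lambda>y. w (m y) y) V"
  have "V \<noteq> {}" using \<open>x \<in> V\<close> by auto
  then have z: "z \<in> V" "\<And>y. y \<in> V \<Longrightarrow> w (m z) z \<le> w (m y) y"
    unfolding z_def using arg_min_if_finite(1)[OF finite_V, of "\<lambda>y. w (m y) y"]
      arg_min_least[OF finite_V, of _ "\<lambda>y. w (m y) y"] by auto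
  define s where "s = m z"
  have s: "0 \<le> s" "s \<le> t" using m(1)[OF z(1)] by (auto simp: s_def)
  have min: "w s z \<le> w s' y" if "y \<in> V" "s' \<in> {0..t}" for y s'
    using z(2)[OF that(1)] m(2)[OF that] by (simp add: s_def)
  have "w t x = heat E t f x / 2"
    using \<open>0 \<le> t\<close> by (simp add: w_def \<epsilon>_def field_simps)
  then have "w s z < 0" using min[of x t] neg \<open>0 \<le> t\<close> \<open>x \<in> V\<close> by auto
  then have "s \<noteq> 0" using f[OF z(1)] \<open>\<epsilon> > 0\<close> by (auto simp: w_def)
  \<comment> \<open>At the fixed time \<open>s\<close> the vertex \<open>z\<close> is a spatial
    minimum, so all differences to its neighbours are nonnegative.\<close>
  have "0 \<le> laplacian E (heat E s f) z"
  proof -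
    have "heat E s f z \<le> heat E s f y" if "y \<in> V" for y
      using min[OF that, of s] s by (simp add: w_def)
    then show ?thesis
      unfolding laplacian_adj by (intro sum_nonneg mult_nonneg_nonneg) auto
  qed
  \<comment> \<open>The time derivative is at least \<epsilon>, so slightly earlier values are
    smaller; \<open>s \<noteq> 0\<close> leaves room to go back.\<close>
  moreover have "((\<lambda>s. w s z) has_real_derivative laplacian E (heat E s f) z + \<epsilon>) (at s)"
    unfolding w_def by (auto intro!: derivative_eq_intros heat_deriv z(1))
  ultimately obtain d where d: "0 < d" "\<And>h. 0 < h \<Longrightarrow> h < d \<Longrightarrow> w (s - h) z < w s z"
    using DERIV_pos_inc_left[of "\<lambda>s. w s z" "laplacian E (heat E s f) z + \<epsilon>" s] \<open>\<epsilon> > 0\<close> by auto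
  have "w (s - min d s / 2) z < w s z"
    using d s \<open>s \<noteq> 0\<close> by (intro d(2)) auto
  moreover have "w s z \<le> w (s - min d s / 2) z"
    using s d(1) z(1) by (intro min) auto
  ultimately show False by simp
qed

subsection \<open>Consequences of the curvature bound\<close>

lemma heat_Gam_deriv:
  assumes "x \<in> V"
  shows "((\<lambda>s. Gam E (heat E s f) (heat E s f) x) has_real_derivative
    2 * Gam E (heat E s f) (laplacian E (heat E s f)) x) (at s)"
  unfolding Gam_adj using assms
  by (auto intro!: derivative_eq_intros heat_deriv simp: sum_distrib_left algebra_simps)

lemma heat_gradient_bound:
  assumes Ric: "Ric_ge V E K" and "0 \<le> t" "- 1 \<le> 2 * K * t" "x \<in> V"
  shows "(heat E t f x)\<^sup>2 + t * Gam E (heat E t f) (heat E t f) x \<le> heat E t (\<lambda>y. (f y)\<^sup>2) x"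
proof -
  define F where "F s y = (heat E s f y)\<^sup>2 + s * Gam E (heat E s f) (heat E s f) y" for s y
  define F' where "F' s y = 2 * heat E s f y * laplacian E (heat E s f) y
    + (Gam E (heat E s f) (heat E s f) y
       + s * (2 * Gam E (heat E s f) (laplacian E (heat E s f)) y))" for s y
  \<comment> \<open>Its endpoints are the two sides of the claim: \<open>\<phi> t = F t x\<close>,
    and \<open>\<phi> 0\<close> is the heat flow of the square of \<open>f\<close> at
    \<open>x\<close>.\<close>
  define \<phi> where "\<phi> s = (\<Sum>y\<in>V. heat E (t - s) (point x) y * F s y)" for s
  have F: "((\<lambda>s. F s y) has_real_derivative F' s y) (at s)" if "y \<in> V" for s y
    unfolding F_def F'_def using that
    by (auto intro!: derivative_eq_intros heat_deriv heat_Gam_deriv)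
  \<comment> \<open>The Leibniz rule cancels the product term and leaves -2 \<open>Gam\<close>;
    differentiating the factor \<open>s\<close> gives back one \<open>Gam\<close>; the terms
    carrying \<open>s\<close> combine to \<open>Gam2\<close>.\<close>
  have LF: "F' s y - laplacian E (F s) y
      = - Gam E (heat E s f) (heat E s f) y - 2 * s * Gam2 E (heat E s f) y" for s y
    unfolding F_def F'_def laplacian_add_cmult laplacian_square Gam2_def
    by (simp add: algebra_simps)
  have nonpos: "F' s y - laplacian E (F s) y \<le> 0" if "y \<in> V" "0 \<le> s" "s \<le> t" for s y
  proof -
    let ?G = "Gam E (heat E s f) (heat E s f) y"
    have "2 * s * (K * ?G) \<le> 2 * s * Gam2 E (heat E s f) y"
      using Ric that by (intro mult_left_mono) (auto simp: Ric_ge_def)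
    \<comment> \<open>The condition is affine in \<open>s\<close>: automatic for nonnegative
      \<open>K\<close>, and strongest at \<open>s = t\<close> for negative \<open>K\<close>.\<close>
    moreover have "- 1 \<le> 2 * K * s"
    proof (cases "0 \<le> K")
      case True
      then show ?thesis using that mult_nonneg_nonneg[of K s] by linarith
    next
      case False
      then show ?thesis using that mult_left_mono_neg[of s t K] assms(3) by linarith
    qed
    then have "0 \<le> (1 + 2 * K * s) * ?G"
      by (intro mult_nonneg_nonneg Gam_nonneg) auto
    ultimately show ?thesis
      unfolding LF by (simp add: algebra_simps)
  qed
  have "\<phi> t \<le> \<phi> 0"
  proof (rule DERIV_nonpos_imp_nonincreasing[OF \<open>0 \<le> t\<close>])
    fix s assume s: "0 \<le> s" "s \<le> t"
    have "(\<phi> has_real_derivative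
      (\<Sum>y\<in>V. heat E (t - s) (point x) y * (F' s y - laplacian E (F s) y))) (at s)"
      unfolding \<phi>_def by (rule heat_pairing_deriv) (rule F)
    moreover have "(\<Sum>y\<in>V. heat E (t - s) (point x) y * (F' s y - laplacian E (F s) y)) \<le> 0"
      using s by (intro sum_nonpos mult_nonneg_nonpos nonpos heat_nonneg) (auto simp: point_def)
    ultimately show "\<exists>D. (\<phi> has_real_derivative D) (at s) \<and> D \<le> 0" by blast
  qed
  then show ?thesis
    using heat_kernel[OF \<open>x \<in> V\<close>, of t "\<lambda>y. (f y)\<^sup>2"] sum_point[OF \<open>x \<in> V\<close>, of "F t"]
    by (simp add: \<phi>_def F_def)
qed

lemma heat_indicator_diff:
  assumes "Ric_ge V E K" and "0 < t" "- 1 \<le> 2 * K * t" "x \<in> V" "{x, y} \<in> E"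
  shows "\<bar>heat E t (indicat_real A) x - heat E t (indicat_real A) y\<bar> \<le> 1 / sqrt (2 * t)"
proof -
  let ?h = "heat E t (indicat_real A)"
  have "y \<in> V" using edges[OF assms(5)] by auto
  have "(\<lambda>y. (indicat_real A y)\<^sup>2) = indicat_real A"
    by (auto simp: indicator_def)
  then have "(?h x)\<^sup>2 + t * Gam E ?h ?h x \<le> ?h x"
    using heat_gradient_bound[OF assms(1) less_imp_le[OF assms(2)] assms(3,4), of "indicat_real A"]
    by simp
  \<comment> \<open>Completing the square: h - h^2 is at most 1/4.\<close>
  moreover have "0 \<le> (?h x - 1/2)\<^sup>2" by simp
  ultimately have "t * Gam E ?h ?h x \<le> 1/4"
    by (simp add: power2_eq_square algebra_simps)
  moreover have "t * (?h x - ?h y)\<^sup>2 \<le> t * (2 * Gam E ?h ?h x)"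
    using assms \<open>y \<in> V\<close> by (intro mult_left_mono sq_diff_le_Gam) auto
  ultimately have "t * (?h x - ?h y)\<^sup>2 \<le> 1 / 2" by linarith
  then have "(?h x - ?h y)\<^sup>2 \<le> 1 / (2 * t)"
    using assms(2) by (simp add: field_simps)
  then show ?thesis
    using real_sqrt_le_mono by (fastforce simp: real_sqrt_divide)
qed

section \<open>Edge boundary and heat loss\<close>

text \<open>An edge crossing the cut has exactly one endpoint in \<open>A\<close>, so distinct
  ordered pairs give distinct edges.\<close>

lemma sum_adj_le_boundary:
  assumes "A \<subseteq> V"
  shows "(\<Sum>x\<in>A. \<Sum>y\<in>V - A. adj x y) \<le> card (edge_boundary V E A)"
proof -
  let ?S = "{(x, y) \<in> A \<times> (V - A). {x, y} \<in> E}"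
  have fin: "finite (A \<times> (V - A))" using assms finite_V finite_subset by auto
  have "(\<Sum>x\<in>A. \<Sum>y\<in>V - A. adj x y) = (\<Sum>p\<in>A \<times> (V - A). of_bool ({fst p, snd p} \<in> E))"
    by (simp add: sum.cartesian_product adj_def case_prod_beta)
  also have "\<dots> = card ?S"
  proof -
    have "?S = {p \<in> A \<times> (V - A). {fst p, snd p} \<in> E}" by auto
    then show ?thesis
      using sum.inter_filter[OF fin, of "\<lambda>_. 1 :: real" "\<lambda>p. {fst p, snd p} \<in> E"]
      by (simp add: of_bool_def)
  qed
  also have "card ?S \<le> card (edge_boundary V E A)"
  proof (rule card_inj_on_le)
    show "inj_on (\<lambda>(x, y). {x, y}) ?S"
      by (auto simp: inj_on_def doubleton_eq_iff)
    show "(\<lambda>(x, y). {x, y}) ` ?S \<subseteq> edge_boundary V E A"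
      by (auto simp: edge_boundary_def)
    have "E \<subseteq> Pow V" using edges by auto
    then show "finite (edge_boundary V E A)"
      using finite_V by (auto simp: edge_boundary_def intro: finite_subset)
  qed
  finally show ?thesis by simp
qed

text \<open>Fluxes inside \<open>A\<close> cancel in pairs: their double sum equals its own
  negative.\<close>

lemma sum_laplacian_subset:
  assumes "A \<subseteq> V"
  shows "(\<Sum>x\<in>A. laplacian E h x) = (\<Sum>x\<in>A. \<Sum>y\<in>V - A. adj x y * (h y - h x))"
proof -
  have "laplacian E h x = (\<Sum>y\<in>V - A. adj x y * (h y - h x)) + (\<Sum>y\<in>A. adj x y * (h y - h x))" for x
    unfolding laplacian_adj using assms finite_V by (rule sum.subset_diff)
  moreover have "(\<Sum>x\<in>A. \<Sum>y\<in>A. adj x y * (h y - h x)) = 0"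
  proof -
    have "(\<Sum>x\<in>A. \<Sum>y\<in>A. adj x y * (h y - h x)) = (\<Sum>x\<in>A. \<Sum>y\<in>A. adj x y * (h x - h y))"
      by (subst sum.swap) (simp add: adj_sym)
    also have "\<dots> = - (\<Sum>x\<in>A. \<Sum>y\<in>A. adj x y * (h y - h x))"
      by (simp add: algebra_simps flip: sum_negf)
    finally show ?thesis by simp
  qed
  ultimately show ?thesis by (simp add: sum.distrib)
qed

lemma heat_mass_loss:
  assumes Ric: "Ric_ge V E K" and "0 < t" "2 * \<bar>K\<bar> * t \<le> 1" and A: "A \<subseteq> V"
  shows "card A - (\<Sum>x\<in>A. heat E t (indicat_real A) x) \<le> sqrt (2 * t) * card (edge_boundary V E A)"
proof -
  define B where "B = real (card (edge_boundary V E A))"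
  \<comment> \<open>At time \<open>s\<close> each boundary edge drains heat at rate at most
    \<open>1 / sqrt (2 * s)\<close>, the derivative of \<open>sqrt (2 * s)\<close>; the second
    summand compensates for the loss.\<close>
  define \<phi> where "\<phi> s = (\<Sum>x\<in>A. heat E s (indicat_real A) x) + B * sqrt (2 * s)" for s
  have "\<phi> 0 \<le> \<phi> t"
  \<comment> \<open>The open interval avoids time 0, where the square root is not
    differentiable.\<close>
  proof (rule DERIV_nonneg_imp_increasing_open[of 0 t \<phi>])
    fix s assume s: "0 < s" "s < t"
    let ?h = "heat E s (indicat_real A)"
    have "2 * \<bar>K\<bar> * s \<le> 1"
      using s assms(3) mult_left_mono[of s t "2 * \<bar>K\<bar>"] by linarith
    then have Ks: "- 1 \<le> 2 * K * s"
      using s mult_right_mono[of "- K" "\<bar>K\<bar>" s] by linarith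
    have "(\<phi> has_real_derivative (\<Sum>x\<in>A. laplacian E ?h x) + B * (1 / sqrt (2 * s))) (at s)"
      unfolding \<phi>_def using s A
      by (auto intro!: derivative_eq_intros heat_deriv simp: field_simps)
    moreover have "- (B * (1 / sqrt (2 * s))) \<le> (\<Sum>x\<in>A. laplacian E ?h x)"
    proof -
      have "- (B * (1 / sqrt (2 * s))) \<le> - ((\<Sum>x\<in>A. \<Sum>y\<in>V - A. adj x y) * (1 / sqrt (2 * s)))"
        unfolding B_def neg_le_iff_le using s
        by (intro mult_right_mono sum_adj_le_boundary A) auto
      also have "\<dots> = (\<Sum>x\<in>A. \<Sum>y\<in>V - A. adj x y * - (1 / sqrt (2 * s)))"
        by (simp add: sum_divide_distrib sum_negf)
      also have "\<dots> \<le> (\<Sum>x\<in>A. \<Sum>y\<in>V - A. adj x y * (?h y - ?h x))"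
      proof (intro sum_mono)
        fix x y assume xy: "x \<in> A" "y \<in> V - A"
        show "adj x y * - (1 / sqrt (2 * s)) \<le> adj x y * (?h y - ?h x)"
        proof (cases "{x, y} \<in> E")
          case True
          then show ?thesis
            using heat_indicator_diff[OF Ric s(1) Ks _ True, of A] xy A by (auto simp: adj_def)
        qed (simp add: adj_def)
      qed
      finally show ?thesis by (simp add: sum_laplacian_subset A)
    qed
    ultimately show "\<exists>D. (\<phi> has_real_derivative D) (at s) \<and> 0 \<le> D" by force
  next
    show "continuous_on {0..t} \<phi>"
      unfolding \<phi>_def using A by (intro continuous_intros heat_continuous) auto
  qed (use assms in auto)
  then show ?thesis by (simp add: \<phi>_def B_def mult.commute)
qed

lemma heat_mass_eq_norm:
  assumes "A \<subseteq> V"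
  shows "(\<Sum>x\<in>A. heat E t (indicat_real A) x) = (\<Sum>x\<in>V. (heat E (t / 2) (indicat_real A) x)\<^sup>2)"
proof -
  have "(\<Sum>x\<in>A. heat E t (indicat_real A) x) = (\<Sum>x\<in>V. heat E t (indicat_real A) x * indicat_real A x)"
    using assms finite_V by (intro sum.mono_neutral_cong_left) (auto simp: indicator_def)
  also have "\<dots> = (\<Sum>x\<in>V. (heat E (t / 2) (indicat_real A) x)\<^sup>2)"
    using heat_pairing_const[of t "t / 2" "indicat_real A" "indicat_real A"]
    by (simp add: power2_eq_square)
  finally show ?thesis .
qed

end

subsection \<open>Hypercontractivity\<close>

text \<open>Serves the limit in the exponent in \<open>hypercontractive_Sup\<close>. If
  \<open>g\<close> is not zero on \<open>V\<close>, the inner sum is positive, as continuity of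
  \<open>powr\<close> requires.\<close>

lemma lp_norm_continuous:
  assumes "finite V" "q > 0"
  shows "((\<lambda>p. lp_norm V p g) \<longlongrightarrow> lp_norm V q g) (at q within S)"
proof (cases "\<forall>v\<in>V. g v = 0")
  case True
  then show ?thesis by (simp add: lp_norm_def)
next
  case False
  then obtain v where "v \<in> V" "g v \<noteq> 0" by blast
  then have "(\<Sum>v\<in>V. \<bar>g v\<bar> powr q) > 0"
    using assms(1) by (intro sum_pos2[of V v]) auto
  moreover have "((\<lambda>p. \<bar>g v\<bar> powr p) \<longlongrightarrow> \<bar>g v\<bar> powr q) (at q within S)" for v
    by (cases "g v = 0") (auto intro!: tendsto_intros)
  ultimately show ?thesis
    unfolding lp_norm_def using assms(2) by (intro tendsto_intros) auto
qed

text \<open>Vacuously true: for \<open>r < q\<close> the square root exceeds 1, while the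
  exponential is at most 1. The value 0 thus makes the set of admissible constants nonempty.\<close>

lemma hypercontractive_nonpos: "\<rho> \<le> 0 \<Longrightarrow> hypercontractive V E \<rho>"
proof -
  assume "\<rho> \<le> 0"
  have "\<not> sqrt ((q - 1) / (r - 1)) \<le> exp (\<rho> * t)" if "1 < r" "r < q" "0 \<le> t" for r q t :: real
  proof -
    have "exp (\<rho> * t) \<le> 1" using \<open>\<rho> \<le> 0\<close> that by (simp add: mult_nonpos_nonneg)
    moreover have "1 < sqrt ((q - 1) / (r - 1))" using that by simp
    ultimately show ?thesis by linarith
  qed
  then show ?thesis by (auto simp: hypercontractive_def)
qed

context finite_graph begin

section \<open>Existence of the log-Sobolev constant\<close>

text \<open>A large constant would give smoothing at a small time: tested on a point mass, it forces
  the heat kernel on the diagonal below n^(-1/3), although it tends to 1 as the time tends to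
  0.\<close>

lemma hypercontractive_bounded:
  assumes "2 \<le> card V"
  obtains M where "\<And>\<rho>. hypercontractive V E \<rho> \<Longrightarrow> \<rho> \<le> M"
proof -
  define n where "n = real (card V)"
  have n: "n \<ge> 2" using assms by (simp add: n_def)
  obtain x where x: "x \<in> V" using assms by fastforce
  have lt1: "n powr (- 1 / 3) < 1"
    using n powr_less_mono[of "- 1 / 3" 0 n] by simp
  have "isCont (\<lambda>t. heat E t (point x) x) 0"
    by (rule DERIV_isCont[OF heat_deriv[OF x]])
  then have "((\<lambda>t. heat E t (point x) x) \<longlongrightarrow> 1) (at_right 0)"
    by (simp add: isCont_def point_def filterlim_at_split)
  then have "eventually (\<lambda>t. n powr (- 1 / 3) < heat E t (point x) x) (at_right 0)"
    using lt1 by (rule order_tendstoD)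
  then obtain t where t: "0 < t" "n powr (- 1 / 3) < heat E t (point x) x"
    by (metis eventually_at_right_field dense)
  \<comment> \<open>The exponents 3/2 and 3 make the square root in the time condition equal to 2,
    hence \<open>ln 2\<close>.\<close>
  have "\<rho> \<le> ln 2 / t" if hyp: "hypercontractive V E \<rho>" for \<rho>
  proof (rule ccontr)
    assume "\<not> \<rho> \<le> ln 2 / t"
    then have "ln 2 < \<rho> * t" using t(1) by (simp add: field_simps)
    then have "2 \<le> exp (\<rho> * t)" using exp_less_mono[of "ln 2" "\<rho> * t"] by simp
    then have "n powr (- 1 / 3) * lp_norm V 3 (heat E t (point x))
        \<le> n powr (- 1 / (3/2)) * lp_norm V (3/2) (point x)"
      using hyp[unfolded hypercontractive_def, rule_format, of "3/2" 3 t "point x"] t(1)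
      by (simp add: n_def)
    also have "lp_norm V (3/2) (point x) = 1"
    proof -
      have "(\<Sum>v\<in>V. \<bar>point x v\<bar> powr (3/2)) = (\<Sum>v\<in>V. point x v * 1)"
        by (intro sum.cong) (auto simp: point_def)
      then show ?thesis by (simp only: lp_norm_def sum_point[OF x]) simp
    qed
    finally have "n powr (- 1 / 3) * lp_norm V 3 (heat E t (point x))
        \<le> n powr (- 1 / 3) * n powr (- 1 / 3)"
      by (simp flip: powr_add)
    then have "lp_norm V 3 (heat E t (point x)) \<le> n powr (- 1 / 3)"
      using n by (simp add: mult_le_cancel_left)
    moreover have "heat E t (point x) x \<le> lp_norm V 3 (heat E t (point x))"
    proof -
      have "\<bar>heat E t (point x) x\<bar> powr 3 \<le> (\<Sum>v\<in>V. \<bar>heat E t (point x) v\<bar> powr 3)"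
        using x finite_V by (intro member_le_sum) auto
      then have "(\<bar>heat E t (point x) x\<bar> powr 3) powr (1/3) \<le> lp_norm V 3 (heat E t (point x))"
        unfolding lp_norm_def by (intro powr_mono2) auto
      then show ?thesis by (simp add: powr_powr del: powr_numeral)
    qed
    ultimately show False using t(2) by simp
  qed
  then show thesis by (rule that)
qed

text \<open>In the borderline case of the time condition, approximate \<open>q\<close> from below.\<close>

lemma hypercontractive_Sup:
  assumes "S \<noteq> {}" "bdd_above S" "\<And>\<rho>. \<rho> \<in> S \<Longrightarrow> hypercontractive V E \<rho>"
  shows "hypercontractive V E (Sup S)"
  unfolding hypercontractive_def
proof (intro allI impI)
  fix r q t f
  assume *: "1 < r \<and> r < q \<and> 0 \<le> t \<and> sqrt ((q - 1) / (r - 1)) \<le> exp (Sup S * t)"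
  let ?n = "real (card V)" and ?h = "heat E t f"
  have "t \<noteq> 0" using * by auto
  then have "0 < t" using * by simp
  have "?n powr (- 1 / p) * lp_norm V p ?h \<le> ?n powr (- 1 / r) * lp_norm V r f"
    if p: "r < p" "p < q" for p
  proof -
    let ?u = "sqrt ((p - 1) / (r - 1))"
    have "?u < sqrt ((q - 1) / (r - 1))"
      using * p by (simp add: divide_strict_right_mono)
    then have "?u < exp (Sup S * t)" using * by linarith
    moreover have u: "0 < ?u" using * p by simp
    ultimately have "ln ?u < Sup S * t" using ln_less_cancel_iff[of ?u "exp (Sup S * t)"] by simp
    then have "ln ?u / t < Sup S" using \<open>0 < t\<close> by (simp add: field_simps)
    \<comment> \<open>Lowering \<open>q\<close> to \<open>p\<close> made the condition strict, which
      leaves room for an element of \<open>S\<close> below the supremum.\<close>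
    then obtain \<sigma> where \<sigma>: "\<sigma> \<in> S" "ln ?u / t < \<sigma>"
      using assms less_cSup_iff by blast
    then have "ln ?u \<le> \<sigma> * t" using \<open>0 < t\<close> by (simp add: field_simps)
    then have "?u \<le> exp (\<sigma> * t)" using u by (metis exp_le_cancel_iff exp_ln)
    then show ?thesis
      using assms(3)[OF \<sigma>(1)] p * unfolding hypercontractive_def by blast
  qed
  then have ev: "eventually (\<lambda>p. ?n powr (- 1 / p) * lp_norm V p ?h
      \<le> ?n powr (- 1 / r) * lp_norm V r f) (at_left q)"
    using * by (auto simp: eventually_at_left_field)
  have "((\<lambda>p. ?n powr (- 1 / p) * lp_norm V p ?h)
      \<longlongrightarrow> ?n powr (- 1 / q) * lp_norm V q ?h) (at_left q)"
  proof (cases "card V = 0")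
    case False
    then show ?thesis
      using * by (intro tendsto_intros lp_norm_continuous finite_V) auto
  qed simp
  then show "?n powr (- 1 / q) * lp_norm V q ?h \<le> ?n powr (- 1 / r) * lp_norm V r f"
    by (rule tendsto_upperbound[OF _ ev]) simp
qed

text \<open>\<open>GREATEST\<close> is informative only if a maximum exists. The supremum of the
  admissible constants is itself admissible, hence the maximum.\<close>

lemma log_sobolev_const_attained_nonneg:
  assumes "2 \<le> card V"
  shows "hypercontractive V E (log_sobolev_const V E)" "0 \<le> log_sobolev_const V E"
proof -
  let ?S = "{\<rho>. hypercontractive V E \<rho>}"
  have bdd: "bdd_above ?S"
    using hypercontractive_bounded[OF assms] by (metis bdd_above.I mem_Collect_eq)
  have "0 \<in> ?S" by (simp add: hypercontractive_nonpos)
  then have "hypercontractive V E (Sup ?S)"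
    using bdd by (intro hypercontractive_Sup) auto
  moreover have "y \<le> Sup ?S" if "hypercontractive V E y" for y
    using that bdd by (intro cSup_upper) auto
  ultimately have "log_sobolev_const V E = Sup ?S"
    unfolding log_sobolev_const_def by (intro Greatest_equality)
  then show "hypercontractive V E (log_sobolev_const V E)" "0 \<le> log_sobolev_const V E"
    using \<open>hypercontractive V E (Sup ?S)\<close> cSup_upper[OF \<open>0 \<in> ?S\<close> bdd] by auto
qed

section \<open>From hypercontractivity to a boundary estimate\<close>

text \<open>The factor next to \<open>L\<close> is tanh(\<rho> t / 2).\<close>

lemma heat_norm_bound:
  assumes hyp: "hypercontractive V E \<rho>" and "0 < \<rho>" "0 < t" and A: "A \<subseteq> V" "A \<noteq> {}"
  defines "L \<equiv> ln (real (card V) / real (card A))"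
  shows "(\<Sum>x\<in>V. (heat E (t / 2) (indicat_real A) x)\<^sup>2)
    \<le> card A * exp (- (L * (2 / (1 + exp (- (\<rho> * t))) - 1)))"
proof -
  define n where "n = real (card V)"
  define a where "a = real (card A)"
  \<comment> \<open>The exponent for which the time condition from \<open>r\<close> to 2 holds with
    equality at time \<open>t / 2\<close>.\<close>
  define r where "r = 1 + exp (- (\<rho> * t))"
  define S where "S = (\<Sum>x\<in>V. (heat E (t / 2) (indicat_real A) x)\<^sup>2)"
  have fin: "finite A" using A finite_V finite_subset by blast
  then have a: "a > 0" using A by (simp add: a_def card_gt_0_iff)
  have n: "n > 0" using A finite_V by (auto simp: n_def card_gt_0_iff)
  have r: "1 < r" "r < 2" using assms(2,3) by (auto simp: r_def)
  have "sqrt ((2 - 1) / (r - 1)) = exp (\<rho> * (t / 2))"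
  proof (rule real_sqrt_unique)
    show "(exp (\<rho> * (t / 2)))\<^sup>2 = (2 - 1) / (r - 1)"
      by (simp add: r_def exp_minus field_simps flip: exp_double)
  qed simp
  then have "n powr (- 1 / 2) * lp_norm V 2 (heat E (t / 2) (indicat_real A))
      \<le> n powr (- 1 / r) * lp_norm V r (indicat_real A)"
    using hyp r \<open>0 < t\<close> unfolding hypercontractive_def n_def by simp
  moreover have "lp_norm V 2 (heat E (t / 2) (indicat_real A)) = S powr (1/2)"
    by (simp add: lp_norm_def S_def)
  moreover have "lp_norm V r (indicat_real A) = a powr (1 / r)"
  proof -
    have "(\<Sum>v\<in>V. \<bar>indicat_real A v\<bar> powr r) = (\<Sum>v\<in>A. 1)"
      using A finite_V by (intro sum.mono_neutral_cong_right) (auto simp: indicator_def)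
    then show ?thesis by (simp add: lp_norm_def a_def)
  qed
  ultimately have "n powr (- 1 / 2) * S powr (1/2) \<le> n powr (- 1 / r) * a powr (1 / r)"
    by simp
  \<comment> \<open>The normalised norm of the indicator is (|A|/n)^(1/r).\<close>
  also have "n powr (- 1 / r) * a powr (1 / r) = exp (- (L / r))"
    using a n by (simp add: powr_def L_def ln_div exp_add[symmetric] diff_divide_distrib
        flip: a_def n_def)
  finally have "(n powr (- 1 / 2) * S powr (1/2))\<^sup>2 \<le> (exp (- (L / r)))\<^sup>2"
    by (intro power_mono) auto
  moreover have "S \<ge> 0" by (simp add: S_def sum_nonneg)
  moreover have "(S powr (1/2))\<^sup>2 = S" "(n powr (- 1 / 2))\<^sup>2 = 1 / n"
    using \<open>S \<ge> 0\<close> n by (simp_all add: powr_half_sqrt powr_minus_divide power_divide)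
  ultimately have "S / n \<le> exp (- (2 * L / r))"
    by (simp add: power_mult_distrib exp_double[symmetric])
  then have "S \<le> n * exp (- (2 * L / r))"
    using n by (simp add: field_simps)
  also have "n = a * exp L"
    using a n by (simp add: L_def flip: a_def n_def)
  also have "a * exp L * exp (- (2 * L / r)) = a * exp (- (L * (2 / r - 1)))"
    by (simp add: exp_add[symmetric] algebra_simps)
  finally show ?thesis by (simp add: S_def a_def r_def)
qed

text \<open>The heat lost by \<open>A\<close> is at least \<open>a * L * u / 5\<close> by
  hypercontractivity and at most \<open>sqrt (2 * t) * B\<close> by curvature; cancelling
  \<open>sqrt t\<close> gives the claim. The time stays free for the final optimisation.\<close>

lemma boundary_lower_bound:
  assumes Ric: "Ric_ge V E K" and hyp: "hypercontractive V E \<rho>" and "0 < \<rho>" "0 < t"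
    and Kt: "2 * \<bar>K\<bar> * t \<le> 1" and A: "A \<subseteq> V" "A \<noteq> {}"
  defines "L \<equiv> ln (real (card V) / real (card A))"
  assumes L: "1 / 2 \<le> L" "\<rho> * t * L \<le> 1"
  shows "real (card A) * (\<rho> * L * sqrt t) \<le> 8 * real (card (edge_boundary V E A))"
proof -
  define a where "a = real (card A)"
  define B where "B = real (card (edge_boundary V E A))"
  define u where "u = \<rho> * t"
  have u: "0 < u" "u * L \<le> 1" using assms by (simp_all add: u_def)
  then have "u \<le> 2" using L mult_left_mono[of "1/2" L u] by linarith
  \<comment> \<open>A linear lower bound for tanh(u/2), valid because
    \<open>u \<le> 2\<close>.\<close>
  have "u / 4 \<le> u / (2 + u)"
    using u \<open>u \<le> 2\<close> by (intro divide_left_mono) auto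
  also have "u / (2 + u) \<le> 2 / (1 + exp (- u)) - 1"
  proof -
    have "exp (- u) \<le> 1 / (1 + u)"
      using exp_ge_add_one_self[of u] u by (simp add: exp_minus field_simps)
    then have "2 / (1 + 1 / (1 + u)) \<le> 2 / (1 + exp (- u))"
      using u by (intro divide_left_mono mult_pos_pos add_pos_pos) auto
    moreover have "2 / (1 + 1 / (1 + u)) - 1 = u / (2 + u)"
      using u by (simp add: field_simps)
    ultimately show ?thesis by linarith
  qed
  finally have "L * (u / 4) \<le> L * (2 / (1 + exp (- u)) - 1)"
    using L by (intro mult_left_mono) auto
  then have "exp (- (L * (2 / (1 + exp (- u)) - 1))) \<le> exp (- (L * (u / 4)))" by simp
  also have "\<dots> \<le> 1 - L * u / 5"
  proof -
    define z where "z = L * u / 4"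
    have z: "0 < z" "z \<le> 1/4" using u L by (auto simp: z_def mult.commute)
    have "exp (- z) \<le> 1 / (1 + z)"
      using exp_ge_add_one_self[of z] z by (simp add: exp_minus field_simps)
    \<comment> \<open>For positive \<open>z\<close> this is equivalent to
      \<open>z \<le> 1/4\<close>.\<close>
    also have "\<dots> \<le> 1 - 4 / 5 * z"
      using z mult_left_mono[of z "1/4" z] by (simp add: field_simps)
    finally show ?thesis by (simp add: z_def)
  qed
  finally have "a * exp (- (L * (2 / (1 + exp (- u)) - 1))) \<le> a * (1 - L * u / 5)"
    by (intro mult_left_mono) (auto simp: a_def)
  moreover have "a - (\<Sum>x\<in>V. (heat E (t / 2) (indicat_real A) x)\<^sup>2) \<le> sqrt (2 * t) * B"
    using heat_mass_loss[OF Ric \<open>0 < t\<close> Kt A(1)]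
    by (simp add: heat_mass_eq_norm A a_def B_def)
  moreover have "(\<Sum>x\<in>V. (heat E (t / 2) (indicat_real A) x)\<^sup>2)
      \<le> a * exp (- (L * (2 / (1 + exp (- u)) - 1)))"
    using heat_norm_bound[OF hyp \<open>0 < \<rho>\<close> \<open>0 < t\<close> A] by (simp add: a_def u_def L_def)
  ultimately have "a * (L * u) \<le> 5 * sqrt (2 * t) * B"
    by (simp add: algebra_simps)
  also have "\<dots> = sqrt t * (5 * sqrt 2 * B)" by (simp add: real_sqrt_mult)
  finally have "sqrt t * (a * (\<rho> * L * sqrt t)) \<le> sqrt t * (5 * sqrt 2 * B)"
    using \<open>0 < t\<close> by (simp add: u_def algebra_simps)
  then have "a * (\<rho> * L * sqrt t) \<le> 5 * sqrt 2 * B"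
    using \<open>0 < t\<close> by (simp add: mult_le_cancel_left)
  also have "\<dots> \<le> 8 * B"
  proof -
    have "sqrt 2 \<le> 8/5" by (rule real_le_lsqrt) (auto simp: power2_eq_square)
    then show ?thesis by (intro mult_right_mono) (auto simp: B_def)
  qed
  finally show ?thesis by (simp add: a_def B_def)
qed

end

section \<open>Choice of the time and conclusion\<close>

theorem theorem17:
  fixes V :: "'a set" and E :: "'a set set" and K :: real and \<rho> :: real and A :: "'a set"
  assumes "simple_graph V E" and "finite V"
    and "Ric_ge V E K"
    and "\<rho> = log_sobolev_const V E"
    and "A \<subseteq> V" and "A \<noteq> {}" and "real (card A) \<le> real (card V) / 2"
  shows "real (card (edge_boundary V E A)) \<ge>
    1/16 * (if K = 0 then sqrt \<rho> else min (sqrt \<rho>) (\<rho> / sqrt (2 * \<bar>K\<bar>)))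
      * real (card A) * sqrt (ln (real (card V) / real (card A)))"
proof -
  interpret finite_graph V E
    using assms(1,2) by (simp add: finite_graph_def finite_graph_axioms_def)
  define a where "a = real (card A)"
  define L where "L = ln (real (card V) / real (card A))"
  define B where "B = real (card (edge_boundary V E A))"
  have "finite A" using assms finite_subset by blast
  then have "card A \<ge> 1" using assms by (simp add: Suc_leI card_gt_0_iff)
  then have card: "2 \<le> card V" "a > 0" "2 \<le> real (card V) / a"
    using assms(7) by (auto simp: a_def field_simps)
  have hyp: "hypercontractive V E \<rho>" and "0 \<le> \<rho>"
    using log_sobolev_const_attained_nonneg[OF card(1)] assms(4) by auto
  \<comment> \<open>Comes from ln(1/2) being at most -1/2; the size condition on \<open>A\<close>
    then gives \<open>ln 2 \<le> L\<close>.\<close>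
  have "1 / 2 \<le> ln (2::real)"
    using ln_le_minus_one[of "1 / 2 :: real"] by (simp add: ln_div)
  also have "ln 2 \<le> L"
    unfolding L_def using card by (intro ln_mono) (auto simp: a_def)
  finally have L: "1 / 2 \<le> L" .
  have "B \<ge> 1/16 * (if K = 0 then sqrt \<rho> else min (sqrt \<rho>) (\<rho> / sqrt (2 * \<bar>K\<bar>))) * a * sqrt L"
    (is "B \<ge> 1/16 * ?m * a * sqrt L")
  proof (cases "\<rho> = 0")
    case True
    then show ?thesis by (simp add: B_def)
  next
    case False
    with \<open>0 \<le> \<rho>\<close> have \<rho>: "0 < \<rho>" by simp
    have bound: "a * (\<rho> * L * sqrt t) \<le> 8 * B"
      if "0 < t" "2 * \<bar>K\<bar> * t \<le> 1" "\<rho> * t * L \<le> 1" for t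
      using boundary_lower_bound[OF assms(3) hyp \<rho> that(1,2) assms(5,6)] L that(3)
      unfolding a_def L_def B_def by blast
    show ?thesis
    \<comment> \<open>Decides which candidate time is admissible; this case, which includes
      \<open>K = 0\<close>, uses \<open>1 / (\<rho> * L)\<close>.\<close>
    proof (cases "2 * \<bar>K\<bar> \<le> \<rho> * L")
      case True
      have "a * (\<rho> * L * sqrt (1 / (\<rho> * L))) \<le> 8 * B"
        using True \<rho> L by (intro bound) (auto simp: field_simps)
      also have "\<rho> * L * sqrt (1 / (\<rho> * L)) = sqrt \<rho> * sqrt L"
        using \<rho> L by (simp add: real_sqrt_divide real_sqrt_mult field_simps)
      finally have "a * (sqrt \<rho> * sqrt L) \<le> 8 * B" .
      moreover have "?m * (a * sqrt L) \<le> sqrt \<rho> * (a * sqrt L)"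
        using card L by (intro mult_right_mono) auto
      moreover have "0 \<le> B" by (simp add: B_def)
      ultimately show ?thesis by (simp add: algebra_simps)
    next
      case False
      then have K: "K \<noteq> 0" using \<rho> L by auto
      define D where "D = \<rho> / sqrt (2 * \<bar>K\<bar>)"
      have "D \<ge> 0" using \<rho> by (simp add: D_def)
      \<comment> \<open>Here the curvature limits the time, and \<rho> L < 2 |K| gives the other
        constraint.\<close>
      have "a * (\<rho> * L * sqrt (1 / (2 * \<bar>K\<bar>))) \<le> 8 * B"
        using False K \<rho> L by (intro bound) (auto simp: field_simps)
      also have "\<rho> * L * sqrt (1 / (2 * \<bar>K\<bar>)) = D * L"
        by (simp add: D_def real_sqrt_divide)
      finally have "D * a * (2 * L) \<le> 16 * B" by (simp add: algebra_simps)
      \<comment> \<open>Passing from \<open>L\<close> to its square root costs a factor 2, which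
        turns the 8 into 16.\<close>
      moreover have "sqrt L \<le> 2 * L"
        using L mult_left_mono[of "1/2" L L]
        by (intro real_le_lsqrt) (auto simp: power2_eq_square)
      then have "D * a * sqrt L \<le> D * a * (2 * L)"
        using \<open>D \<ge> 0\<close> card by (intro mult_left_mono) auto
      moreover have "?m * (a * sqrt L) \<le> D * (a * sqrt L)"
        using K card L by (intro mult_right_mono) (auto simp: D_def)
      ultimately have "?m * (a * sqrt L) \<le> 16 * B" by linarith
      then show ?thesis by simp
    qed
  qed
  then show ?thesis by (simp only: a_def L_def B_def)
qed

end
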